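(* Let $r\ge 3$ and $n\ge 1$ be integers. Then $$ex_r^{\mathrm{lin}}(n,E_4^r)\le \frac{(2r-1)n}{r}.$$
   Context: All hypergraphs are finite. A hypergraph is $r$-uniform if each hyperedge has exactly $r$ vertices, and linear if any two distinct hyperedges intersect in at most one vertex. A hypergraph $H$ contains $F$ as a subhypergraph if there is an injective map $V(F)\to V(H)$ sending every hyperedge of $F$ to a hyperedge of $H$; otherwise $H$ is $F$-free. The linear Turán number $ex_r^{\mathrm{lin}}(n,F)$ is the maximum number of hyperedges in an $F$-free linear $r$-uniform hypergraph on $n$ vertices. The crown $E_4^r$ is the linear $r$-uniform hypergraph consisting of three pairwise disjoint hyperedges together with a fourth hyperedge (the base) that intersects each of the other three in exactly one vertex. *)

theory Defs
  imports Complex_Main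
begin

record 'a hypergraph =
  verts :: "'a set"
  edges :: "'a set set"

definition hypergraph :: "'a hypergraph \<Rightarrow> bool" where
  "hypergraph H \<longleftrightarrow> finite (verts H) \<and> (\<forall>e\<in>edges H. e \<subseteq> verts H)"

definition uniform :: "nat \<Rightarrow> 'a hypergraph \<Rightarrow> bool" where
  "uniform r H \<longleftrightarrow> (\<forall>e\<in>edges H. card e = r)"

definition linear_hypergraph :: "'a hypergraph \<Rightarrow> bool" where
  "linear_hypergraph H \<longleftrightarrow>
    (\<forall>e\<in>edges H. \<forall>e'\<in>edges H. e \<noteq> e' \<longrightarrow> card (e \<inter> e') \<le> 1)"

definition contains_sub :: "'a hypergraph \<Rightarrow> 'b hypergraph \<Rightarrow> bool" where
  "contains_sub H F \<longleftrightarrow>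
    (\<exists>f. inj_on f (verts F) \<and> f ` verts F \<subseteq> verts H \<and> (\<forall>e\<in>edges F. f ` e \<in> edges H))"

text \<open>Every hypergraph on \<open>n\<close> vertices is isomorphic to one whose vertices are natural
  numbers, so it suffices to range over these.\<close>

definition lin_free_hypergraphs :: "nat \<Rightarrow> nat \<Rightarrow> 'b hypergraph \<Rightarrow> nat hypergraph set" where
  "lin_free_hypergraphs r n F =
    {H. hypergraph H \<and> card (verts H) = n \<and> uniform r H \<and> linear_hypergraph H
        \<and> \<not> contains_sub H F}"

text \<open>The maximum is over a finite nonempty set whenever \<open>F\<close> has an edge; see
  \<open>ex_lin_finite\<close> and \<open>ex_lin_nonempty\<close> below.\<close>

definition ex_lin :: "nat \<Rightarrow> nat \<Rightarrow> 'b hypergraph \<Rightarrow> nat" where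
  "ex_lin r n F = Max ((\<lambda>H. card (edges H)) ` lin_free_hypergraphs r n F)"

text \<open>\<open>crown r F\<close> says that \<open>F\<close> is (a copy of) the crown; \<open>D\<close> is the base. The last
  conjunct excludes isolated vertices.\<close>

definition crown :: "nat \<Rightarrow> 'a hypergraph \<Rightarrow> bool" where
  "crown r F \<longleftrightarrow>
    hypergraph F \<and> uniform r F \<and> linear_hypergraph F \<and>
    (\<exists>A B C D. edges F = {A, B, C, D} \<and>
       A \<inter> B = {} \<and> A \<inter> C = {} \<and> B \<inter> C = {} \<and>
       card (D \<inter> A) = 1 \<and> card (D \<inter> B) = 1 \<and> card (D \<inter> C) = 1) \<and>
    verts F = \<Union>(edges F)"

lemma ex_lin_finite: "finite ((\<lambda>H. card (edges H)) ` lin_free_hypergraphs r n F)"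
proof (rule finite_subset)
  show "(\<lambda>H. card (edges H)) ` lin_free_hypergraphs r n F \<subseteq> {..2 ^ n}"
  proof (rule image_subsetI)
    fix H assume "H \<in> lin_free_hypergraphs r n F"
    then have "finite (verts H)" "edges H \<subseteq> Pow (verts H)" "card (verts H) = n"
      by (auto simp: lin_free_hypergraphs_def hypergraph_def)
    then show "card (edges H) \<in> {..2 ^ n}"
      using card_mono[of "Pow (verts H)" "edges H"] by (simp add: card_Pow)
  qed
qed simp

lemma ex_lin_nonempty:
  assumes "edges F \<noteq> {}"
  shows "(\<lambda>H. card (edges H)) ` lin_free_hypergraphs r n F \<noteq> {}"
proof -
  have "\<lparr>verts = {..<n}, edges = {}\<rparr> \<in> lin_free_hypergraphs r n F"
    using assms by (auto simp: lin_free_hypergraphs_def hypergraph_def uniform_def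
        linear_hypergraph_def contains_sub_def)
  then show ?thesis by blast
qed

lemma crown_exists:
  assumes "r \<ge> 3"
  shows "\<exists>F :: nat hypergraph. crown r F"
proof -
  define A B C D where "A = {0..<r}" and "B = {r..<2*r}" and "C = {2*r..<3*r}"
    and "D = {0, r, 2*r} \<union> {3*r..<4*r-3}"
  let ?F = "\<lparr>verts = A \<union> B \<union> C \<union> D, edges = {A, B, C, D}\<rparr>"
  have disj: "A \<inter> B = {}" "A \<inter> C = {}" "B \<inter> C = {}"
    by (auto simp: A_def B_def C_def)
  have base: "D \<inter> A = {0}" "D \<inter> B = {r}" "D \<inter> C = {2*r}"
    using assms by (auto simp: A_def B_def C_def D_def)
  have disj': "B \<inter> A = {}" "C \<inter> A = {}" "C \<inter> B = {}"
    and base': "A \<inter> D = {0}" "B \<inter> D = {r}" "C \<inter> D = {2*r}"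
    using disj base by (simp_all only: Int_commute)
  have fin: "finite A" "finite B" "finite C" "finite D"
    by (auto simp: A_def B_def C_def D_def)
  have "card D = card {0, r, 2*r} + card {3*r..<4*r-3}"
    unfolding D_def using assms by (intro card_Un_disjoint) auto
  then have cards: "card A = r" "card B = r" "card C = r" "card D = r"
    using assms by (auto simp: A_def B_def C_def)
  have "linear_hypergraph ?F"
    using disj disj' base base' by (simp add: linear_hypergraph_def)
  moreover have "hypergraph ?F"
    using fin by (auto simp: hypergraph_def)
  moreover have "uniform r ?F"
    using cards by (simp add: uniform_def)
  moreover have "verts ?F = \<Union>(edges ?F)"
    by (simp add: Un_assoc)
  moreover have "card (D \<inter> A) = 1" "card (D \<inter> B) = 1" "card (D \<inter> C) = 1"
    by (simp_all add: base)
  ultimately have "crown r ?F"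
    unfolding crown_def using disj by (metis hypergraph.select_convs(2))
  then show ?thesis by blast
qed

end

(* Each vertex of positive degree spreads weight 1 evenly over its edges, so it suffices that every
   edge D receives at least r/(2r-1), the sum of 1/deg v over v in D. This is clear when all degrees
   in D are below 2r. Otherwise some v in D has degree at least 2r, and a greedy choice of three
   disjoint edges shows that D cannot contain u, w with deg u > r and deg w > 1 as well. So
   either all other vertices of D have degree at most r, giving weight at least (r-1)/r, or r-2 of
   them have degree 1, giving weight at least 1. *)
theory Submission
  imports Defs
begin

definition degree :: "'a hypergraph \<Rightarrow> 'a \<Rightarrow> nat" where
  "degree H v = card {e \<in> edges H. v \<in> e}"

lemma finite_edges: "hypergraph H \<Longrightarrow> finite (edges H)"
  unfolding hypergraph_def by (meson PowI finite_Pow_iff finite_subset subsetI)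

lemma finite_edge: "hypergraph H \<Longrightarrow> e \<in> edges H \<Longrightarrow> finite e"
  unfolding hypergraph_def by (meson finite_subset)

lemma linear_hypergraphD:
  assumes "hypergraph H" "linear_hypergraph H" "e \<in> edges H" "e' \<in> edges H" "e \<noteq> e'"
    and "x \<in> e" "x \<in> e'" "y \<in> e" "y \<in> e'"
  shows "x = y"
proof -
  have "card (e \<inter> e') \<le> 1"
    using assms unfolding linear_hypergraph_def by blast
  moreover have "finite (e \<inter> e')"
    using finite_edge[OF assms(1,3)] by blast
  ultimately show ?thesis
    using assms by (metis IntI One_nat_def card_le_Suc0_iff_eq)
qed

lemma linear_hypergraph_Int_eq:
  assumes "hypergraph H" "linear_hypergraph H" "e \<in> edges H" "e' \<in> edges H" "e \<noteq> e'"
    and "x \<in> e" "x \<in> e'"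
  shows "e \<inter> e' = {x}"
  using linear_hypergraphD[OF assms] assms(6,7) by blast

lemma degree_pos:
  assumes "hypergraph H" "e \<in> edges H" "v \<in> e"
  shows "degree H v > 0"
  using assms finite_edges[OF assms(1)] unfolding degree_def by (auto simp: card_gt_0_iff)

text \<open>Pigeonhole: if every edge through \<open>v\<close> met \<open>X\<close>, picking a point
  of \<open>X\<close> on each would be injective, because two edges through \<open>v\<close> share
  only \<open>v\<close>, which lies outside \<open>X\<close>. Then \<open>v\<close> would have
  degree at most \<open>card X\<close>.\<close>

lemma edge_avoiding:
  assumes H: "hypergraph H" "linear_hypergraph H"
    and X: "finite X" "v \<notin> X" "card X < degree H v"
  shows "\<exists>e\<in>edges H. v \<in> e \<and> e \<inter> X = {}"
proof (rule ccontr)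
  assume "\<not> ?thesis"
  then have "\<forall>e\<in>{e \<in> edges H. v \<in> e}. \<exists>x. x \<in> e \<inter> X"
    by blast
  then obtain g where g: "\<And>e. e \<in> edges H \<Longrightarrow> v \<in> e \<Longrightarrow> g e \<in> e \<inter> X"
    by (metis (mono_tags, lifting) mem_Collect_eq)
  have "inj_on g {e \<in> edges H. v \<in> e}"
  proof (rule inj_onI, rule ccontr)
    fix e e'
    assume e: "e \<in> {e \<in> edges H. v \<in> e}" "e' \<in> {e \<in> edges H. v \<in> e}"
      and "g e = g e'" "e \<noteq> e'"
    then have "g e = v"
      using linear_hypergraphD[OF H, of e e' "g e" v] g[of e] g[of e'] by auto
    then show False
      using g[of e] e X(2) by auto
  qed
  moreover have "g ` {e \<in> edges H. v \<in> e} \<subseteq> X"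
    using g by blast
  ultimately have "degree H v \<le> card X"
    unfolding degree_def using X(1) by (rule card_inj_on_le)
  then show False
    using X(3) by simp
qed

text \<open>Serves to map an edge of the crown onto an edge of \<open>H\<close> so that its meeting
  point with the base goes to the prescribed one.\<close>

lemma ex_bij_betw_pointed:
  assumes "finite X" "finite Y" "card X = card Y" "x \<in> X" "y \<in> Y"
  shows "\<exists>f. bij_betw f X Y \<and> f x = y"
proof -
  have "card (X - {x}) = card (Y - {y})"
    using assms by simp
  then obtain g where "bij_betw g (X - {x}) (Y - {y})"
    using assms finite_same_card_bij[of "X - {x}" "Y - {y}"] by blast
  then have "bij_betw (g(x := y)) (X - {x}) (Y - {y})"
    by (subst bij_betw_cong[of _ _ g]) auto
  then have "bij_betw (g(x := y)) (insert x (X - {x})) (insert ((g(x := y)) x) (Y - {y}))"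
    by (intro notIn_Un_bij_betw[of x _ _ "Y - {y}", simplified]) auto
  then have "bij_betw (g(x := y)) X Y"
    using assms by (simp add: insert_absorb)
  then show ?thesis
    by (intro exI[of _ "g(x := y)"]) simp
qed

text \<open>The intersection pattern determines the crown up to isomorphism: bijections on the three
  disjoint edges that respect the meeting points, together with one on the rest of the base, glue to
  an embedding.\<close>

lemma contains_crown:
  assumes F: "crown r F" and H: "hypergraph H" "uniform r H"
    and edges: "A' \<in> edges H" "B' \<in> edges H" "C' \<in> edges H" "D' \<in> edges H"
    and disj': "A' \<inter> B' = {}" "A' \<inter> C' = {}" "B' \<inter> C' = {}"
    and base': "D' \<inter> A' = {a'}" "D' \<inter> B' = {b'}" "D' \<inter> C' = {c'}"
  shows "contains_sub H F"
proof -
  obtain A B C D where E: "edges F = {A, B, C, D}"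
    and disj: "A \<inter> B = {}" "A \<inter> C = {}" "B \<inter> C = {}"
    and "card (D \<inter> A) = 1" "card (D \<inter> B) = 1" "card (D \<inter> C) = 1"
    and V: "verts F = A \<union> B \<union> C \<union> D" and hF: "hypergraph F" and uF: "uniform r F"
    using F unfolding crown_def by (auto simp: Un_assoc)
  then obtain a b c where base: "D \<inter> A = {a}" "D \<inter> B = {b}" "D \<inter> C = {c}"
    by (auto simp: card_1_singleton_iff)
  have cards: "card A = r" "card B = r" "card C = r" "card D = r"
    using uF E by (auto simp: uniform_def)
  have cards': "card A' = r" "card B' = r" "card C' = r" "card D' = r"
    using H(2) edges by (auto simp: uniform_def)
  have fin: "finite A" "finite B" "finite C" "finite D"
    using finite_edge[OF hF] E by auto
  have fin': "finite A'" "finite B'" "finite C'" "finite D'"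
    using finite_edge[OF H(1)] edges by auto
  have "a \<in> D \<inter> A" "b \<in> D \<inter> B" "c \<in> D \<inter> C"
    and "a' \<in> D' \<inter> A'" "b' \<in> D' \<inter> B'" "c' \<in> D' \<inter> C'"
    unfolding base base' by simp_all
  then have mem: "a \<in> A" "b \<in> B" "c \<in> C" "a \<in> D" "b \<in> D" "c \<in> D"
    "a' \<in> A'" "b' \<in> B'" "c' \<in> C'" "a' \<in> D'" "b' \<in> D'" "c' \<in> D'"
    by simp_all
  then have ne: "a \<noteq> b" "a \<noteq> c" "b \<noteq> c" "a' \<noteq> b'" "a' \<noteq> c'" "b' \<noteq> c'"
    using disj disj' by auto
  \<comment> \<open>Each base splits into three meeting points, already placed by the maps on the
    disjoint edges, and \<open>r - 3\<close> private vertices (none if \<open>r = 3\<close>), for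
    which any bijection will do.\<close>
  define R R' where "R = D - {a, b, c}" and "R' = D' - {a', b', c'}"
  have "card {a, b, c} = 3" "card {a', b', c'} = 3"
    using ne by auto
  then have "card R = r - 3" "card R' = r - 3"
    unfolding R_def R'_def using mem cards(4) cards'(4) by (simp_all add: card_Diff_subset)
  then have "card R = card R'"
    by simp
  moreover have "finite R" "finite R'"
    using fin fin' by (auto simp: R_def R'_def)
  ultimately obtain k where k: "bij_betw k R R'"
    using finite_same_card_bij by blast
  obtain f where f: "bij_betw f A A'" "f a = a'"
    using ex_bij_betw_pointed[of A A' a a'] fin fin' cards cards' mem by auto
  obtain g where g: "bij_betw g B B'" "g b = b'"
    using ex_bij_betw_pointed[of B B' b b'] fin fin' cards cards' mem by auto
  obtain h where h: "bij_betw h C C'" "h c = c'"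
    using ex_bij_betw_pointed[of C C' c c'] fin fin' cards cards' mem by auto
  have disjR: "A \<inter> R = {}" "B \<inter> R = {}" "C \<inter> R = {}"
    using base by (auto simp: R_def)
  have disjR': "A' \<inter> R' = {}" "B' \<inter> R' = {}" "C' \<inter> R' = {}"
    using base' by (auto simp: R'_def)
  define \<phi> where
    "\<phi> v = (if v \<in> A then f v else if v \<in> B then g v else if v \<in> C then h v else k v)" for v
  have "\<phi> v = g v" if "v \<in> B" for v
    using that disj(1) by (auto simp: \<phi>_def)
  moreover have "\<phi> v = h v" if "v \<in> C" for v
    using that disj(2,3) by (auto simp: \<phi>_def)
  moreover have "\<phi> v = k v" if "v \<in> R" for v
    using that disjR by (auto simp: \<phi>_def)
  ultimately have \<phi>: "bij_betw \<phi> A A'" "bij_betw \<phi> B B'" "bij_betw \<phi> C C'" "bij_betw \<phi> R R'"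
    using f(1) g(1) h(1) k bij_betw_cong[of A \<phi> f] bij_betw_cong[of B \<phi> g]
      bij_betw_cong[of C \<phi> h] bij_betw_cong[of R \<phi> k]
    by (simp_all add: \<phi>_def)
  have "bij_betw \<phi> (A \<union> B \<union> C \<union> R) (A' \<union> B' \<union> C' \<union> R')"
    by (intro bij_betw_combine \<phi>) (use disj' disjR' in \<open>simp_all add: Int_Un_distrib2\<close>)
  moreover have D: "D = {a, b, c} \<union> R" "D' = {a', b', c'} \<union> R'"
    using mem by (auto simp: R_def R'_def)
  then have "verts F = A \<union> B \<union> C \<union> R"
    using V mem by auto
  ultimately have "inj_on \<phi> (verts F)" "\<phi> ` verts F = A' \<union> B' \<union> C' \<union> R'"
    by (auto simp: bij_betw_def)
  moreover have "A' \<union> B' \<union> C' \<union> R' \<subseteq> verts H"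
    using edges H(1) unfolding hypergraph_def R'_def by auto
  moreover have "\<phi> a = a'" "\<phi> b = b'" "\<phi> c = c'"
    using f(2) g(2) h(2) mem disj by (auto simp: \<phi>_def)
  then have "\<phi> ` D = D'"
    using \<phi>(4) unfolding D bij_betw_def by (simp add: image_Un)
  ultimately show ?thesis
    unfolding contains_sub_def E using edges \<phi>
    by (intro exI[of _ \<phi>]) (auto simp: bij_betw_def)
qed

text \<open>Greedy choice with \<open>D\<close> as base, starting at the weakest degree condition:
  \<open>C\<close> through \<open>w\<close> only has to differ from \<open>D\<close>,
  \<open>B\<close> through \<open>u\<close> has to avoid the \<open>r\<close> points of
  \<open>C\<close>, and \<open>A\<close> through \<open>v\<close> has to avoid both \<open>B\<close>
  and \<open>C\<close>.\<close>

lemma crown_from_degrees: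
  assumes F: "crown r F" and H: "hypergraph H" "uniform r H" "linear_hypergraph H"
    and D: "D \<in> edges H" "v \<in> D" "u \<in> D" "w \<in> D" "v \<noteq> u" "v \<noteq> w" "u \<noteq> w"
    and deg: "degree H v \<ge> 2 * r" "degree H u > r" "degree H w > 1"
  shows "contains_sub H F"
proof -
  note Int_D = linear_hypergraph_Int_eq[OF H(1,3) D(1)]
  have "\<not> {e \<in> edges H. w \<in> e} \<subseteq> {D}"
    using deg(3) card_mono[of "{D}" "{e \<in> edges H. w \<in> e}"] by (auto simp: degree_def)
  then obtain C where C: "C \<in> edges H" "w \<in> C" "D \<noteq> C"
    by blast
  have DC: "D \<inter> C = {w}"
    using Int_D[of C w] C D by blast
  have fC: "finite C" "card C = r"
    using finite_edge[OF H(1)] H(2) C(1) by (auto simp: uniform_def)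
  \<comment> \<open>\<open>C\<close> meets \<open>D\<close> only in \<open>w\<close>, so
    \<open>u\<close> is not among the \<open>r\<close> points to be avoided.\<close>
  obtain B where B: "B \<in> edges H" "u \<in> B" "B \<inter> C = {}"
    using edge_avoiding[OF H(1,3) fC(1), of u] fC(2) deg(2) D DC by blast
  have DB: "D \<inter> B = {u}"
    using Int_D[of B u] B C D by blast
  have fB: "finite B" "card B = r"
    using finite_edge[OF H(1)] H(2) B(1) by (auto simp: uniform_def)
  have "r > 0"
    using fC C(2) by (auto simp: card_gt_0_iff)
  \<comment> \<open>\<open>w\<close> may be left out since no second edge through \<open>v\<close> contains it; this saves the one
    degree that would be missing.\<close>
  have "card (B \<union> (C - {w})) \<le> r + (r - 1)"
    using card_Un_le[of B "C - {w}"] fB fC C(2) by simp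
  then have "card (B \<union> (C - {w})) < degree H v"
    using deg(1) \<open>r > 0\<close> by linarith
  then obtain A where A: "A \<in> edges H" "v \<in> A" "A \<inter> (B \<union> (C - {w})) = {}"
    using edge_avoiding[OF H(1,3), of "B \<union> (C - {w})" v] fB fC D DC DB by blast
  have DA: "D \<inter> A = {v}"
    using Int_D[of A v] A B D by blast
  have "A \<inter> B = {}" "A \<inter> C = {}"
    using A(3) DA D by blast+
  then show ?thesis
    using contains_crown[OF F H(1,2) A(1) B(1) C(1) D(1)] B(3) DA DB DC by blast
qed

lemma edge_weight:
  assumes F: "crown r F" and H: "hypergraph H" "uniform r H" "linear_hypergraph H"
    and free: "\<not> contains_sub H F" and r: "r \<ge> 3" and D: "D \<in> edges H"
  shows "(\<Sum>v\<in>D. 1 / real (degree H v)) \<ge> real r / (2 * real r - 1)"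
proof -
  have fD: "finite D" "card D = r"
    using finite_edge[OF H(1) D] H(2) D by (auto simp: uniform_def)
  \<comment> \<open>Lying on the edge \<open>D\<close> makes the degree positive; a degree 0 would
    give \<open>1 / 0 = 0\<close> and could violate the bound.\<close>
  have ge: "1 / real (degree H v) \<ge> 1 / k" if "v \<in> D" "real (degree H v) \<le> k" for v k
    using degree_pos[OF H(1) D that(1)] that(2) by (intro divide_left_mono) auto
  show ?thesis
  proof (cases "\<exists>v\<in>D. degree H v \<ge> 2 * r")
    case False
    \<comment> \<open>Degrees are integers, so below \<open>2 * r\<close> means at most
      \<open>2 * r - 1\<close>. The \<open>r\<close> equal lower bounds then add up to exactly the
      target value; this case sets the constant.\<close>
    then have "real (degree H v) \<le> 2 * real r - 1" if "v \<in> D" for v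
      using that by fastforce
    then have "(\<Sum>v\<in>D. 1 / real (degree H v)) \<ge> (\<Sum>v\<in>D. 1 / (2 * real r - 1))"
      by (intro sum_mono ge) auto
    then show ?thesis
      using fD by simp
  next
    case True
    then obtain v where v: "v \<in> D" "degree H v \<ge> 2 * r"
      by blast
    show ?thesis
    proof (cases "\<exists>u\<in>D - {v}. degree H u > r")
      case False
      \<comment> \<open>Cross-multiplied, this is \<open>r^2 - 3 * r + 1 \<ge> 0\<close>, which
        follows from \<open>r \<ge> 3\<close>.\<close>
      have "real r / (2 * real r - 1) \<le> (real r - 1) / real r"
      proof -
        have "real r * real r \<ge> 3 * real r"
          using r by (intro mult_right_mono) auto
        moreover have "(real r - 1) * (2 * real r - 1) = 2 * (real r * real r) - 3 * real r + 1"
          by (simp add: algebra_simps)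
        ultimately have "real r * real r \<le> (real r - 1) * (2 * real r - 1)"
          by linarith
        then show ?thesis
          using r by (simp add: divide_le_eq le_divide_eq mult.commute)
      qed
      also have "\<dots> = (\<Sum>u\<in>D - {v}. 1 / real r)"
        using fD v(1) r by (simp add: of_nat_diff)
      also have "\<dots> \<le> (\<Sum>u\<in>D - {v}. 1 / real (degree H u))"
        using False by (intro sum_mono ge) (auto simp: not_less)
      also have "\<dots> \<le> (\<Sum>u\<in>D. 1 / real (degree H u))"
        using fD by (intro sum_mono2) auto
      finally show ?thesis .
    next
      case True
      then obtain u where u: "u \<in> D" "u \<noteq> v" "degree H u > r"
        by blast
      have deg1: "degree H w \<le> 1" if "w \<in> D - {v, u}" for w
        using crown_from_degrees[OF F H D v(1) u(1), of w] that u v(2) free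
        by (force simp: not_less)
      \<comment> \<open>The \<open>r - 2\<close> vertices other than \<open>v\<close> and
        \<open>u\<close> have degree 1 and contribute 1 each. Since \<open>r \<ge> 3\<close> there
        is at least one of them, and the target is at most 1.\<close>
      have "real r / (2 * real r - 1) \<le> real r - 2"
      proof -
        have "real r / (2 * real r - 1) \<le> 1"
          using r by simp
        then show ?thesis
          using r by linarith
      qed
      also have "\<dots> = (\<Sum>w\<in>D - {v, u}. 1 / 1)"
        using fD v(1) u(1,2) r by (simp add: card_Diff_subset of_nat_diff)
      also have "\<dots> \<le> (\<Sum>w\<in>D - {v, u}. 1 / real (degree H w))"
        using deg1 by (intro sum_mono ge) auto
      also have "\<dots> \<le> (\<Sum>w\<in>D. 1 / real (degree H w))"
        using fD by (intro sum_mono2) auto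
      finally show ?thesis .
    qed
  qed
qed

text \<open>Double counting: after swapping the sums, a vertex of positive degree contributes its
  degree times the reciprocal, which is 1, and an isolated vertex contributes an empty sum. Isolated
  vertices are why this is only an inequality.\<close>

lemma sum_edge_weights_le:
  assumes H: "hypergraph H"
  shows "(\<Sum>e\<in>edges H. \<Sum>v\<in>e. 1 / real (degree H v)) \<le> real (card (verts H))"
proof -
  have fin: "finite (verts H)" and sub: "\<And>e. e \<in> edges H \<Longrightarrow> e \<subseteq> verts H"
    using H by (auto simp: hypergraph_def)
  have "(\<Sum>e\<in>edges H. \<Sum>v\<in>e. 1 / real (degree H v)) =
      (\<Sum>e\<in>edges H. \<Sum>v | v \<in> verts H \<and> v \<in> e. 1 / real (degree H v))"
    using sub by (intro sum.cong) auto
  also have "\<dots> = (\<Sum>v\<in>verts H. \<Sum>e | e \<in> edges H \<and> v \<in> e. 1 / real (degree H v))"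
    using finite_edges[OF H] fin by (rule sum.swap_restrict)
  also have "\<dots> \<le> (\<Sum>v\<in>verts H. 1)"
    by (intro sum_mono) (simp add: degree_def)
  finally show ?thesis
    by simp
qed

lemma card_edges_crown_free_le:
  assumes F: "crown r F" and H: "hypergraph H" "uniform r H" "linear_hypergraph H"
    and free: "\<not> contains_sub H F" and r: "r \<ge> 3"
  shows "real (card (edges H)) \<le> (2 * real r - 1) * real (card (verts H)) / real r"
proof -
  have "real (card (edges H)) * (real r / (2 * real r - 1)) \<le>
      (\<Sum>e\<in>edges H. \<Sum>v\<in>e. 1 / real (degree H v))"
    using edge_weight[OF F H free r] by (intro sum_bounded_below) auto
  also have "\<dots> \<le> real (card (verts H))"
    by (rule sum_edge_weights_le[OF H(1)])
  finally show ?thesis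
    using r by (simp add: field_simps)
qed

theorem theorem4:
  fixes r n :: nat and F :: "'a hypergraph"
  assumes "r \<ge> 3" and "n \<ge> 1" and "crown r F"
  shows "real (ex_lin r n F) \<le> (2 * real r - 1) * real n / real r"
proof -
  \<comment> \<open>With an edge in \<open>F\<close>, the edgeless hypergraph is
    \<open>F\<close>-free, so \<open>Max\<close> ranges over a nonempty finite set and is attained
    by some hypergraph to which the bound applies.\<close>
  have "edges F \<noteq> {}"
    using assms(3) by (auto simp: crown_def)
  then have "ex_lin r n F \<in> (\<lambda>H. card (edges H)) ` lin_free_hypergraphs r n F"
    unfolding ex_lin_def by (intro Max_in ex_lin_finite ex_lin_nonempty)
  then show ?thesis
    using card_edges_crown_free_le[OF assms(3) _ _ _ _ assms(1)]
    by (auto simp: lin_free_hypergraphs_def)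
qed

end
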